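(* Let $t\in\mathbb{N}$, let $f:2^\Omega\to\mathbb{R}$ be a set function with $\Omega=\{1,\dots,n\}$, and let $F$ be its multilinear extension. Then $f$ is $t$-sos-submodular if and only if the polynomial $H_1(x,y):=F(x)-F(y)+\sum_{i=1}^n(y_i-x_i)\cdot\frac{\partial F(x)}{\partial x_i}$ is $(t+2)$-sos modulo $I_1[x,y]$.
   Context: $\mathbb{N}$ includes $0$. The multilinear extension (MLE) of a set function $f:2^\Omega\to\mathbb{R}$ is the unique multilinear polynomial $F\in\mathbb{R}[x_1,\dots,x_n]$ (every variable appears with power at most $1$ in every monomial) with $F(1_S)=f(S)$ for all $S\subseteq\Omega$, where $1_S\in\{0,1\}^n$ is the indicator vector of $S$. For an ideal $I$ of a real polynomial ring, a polynomial $p$ is $t$-sos modulo $I$ if there are finitely many polynomials $q_1,\dots,q_m$ in that ring, each of degree at most $t$, with $p-\sum_{r=1}^m q_r^2\in I$. For $i\ne j$, $x_{-i,j}$ denotes the variables $x_1,\dots,x_n$ with $x_i,x_j$ removed, and $I_2[x_{-i,j}]=\langle x_k^2-x_k : k\neq i,j\rangle\subseteq\mathbb{R}[x_{-i,j}]$. The set function $f$ with MLE $F$ is $t$-sos-submodular if for all $i\neq j$ the polynomial $-\frac{\partial^2F(x)}{\partial x_i\partial x_j}$ (which does not involve $x_i,x_j$) is $t$-sos modulo $I_2[x_{-i,j}]$. With variables $x=(x_1,\dots,x_n)$, $y=(y_1,\dots,y_n)$, $I_1[x,y]=\langle\{x_i^2-x_i,\ x_iy_i-x_i,\ y_i^2-y_i\}_{i=1,\dots,n}\rangle\subseteq\mathbb{R}[x,y]$.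 *)

theory Defs
  imports Complex_Main "HOL-Library.Poly_Mapping"
begin

text \<open>
  Real polynomials in variables of type \<open>'v\<close>, as finitely supported maps from monomials
  (finitely supported exponent vectors) to coefficients; the ring operations are those of
  \<open>HOL-Library.Poly_Mapping\<close> (convolution product).
\<close>

type_synonym 'v rpoly = "('v \<Rightarrow>\<^sub>0 nat) \<Rightarrow>\<^sub>0 real"

definition const_poly :: "real \<Rightarrow> 'v rpoly" where
  "const_poly c = Poly_Mapping.single 0 c"

definition var_poly :: "'v \<Rightarrow> 'v rpoly" where
  "var_poly v = Poly_Mapping.single (Poly_Mapping.single v 1) 1"

definition indets :: "'v rpoly \<Rightarrow> 'v set" where
  "indets p = (\<Union>m\<in>Poly_Mapping.keys p. Poly_Mapping.keys m)"

definition poly_ring :: "'v set \<Rightarrow> 'v rpoly set" where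
  "poly_ring V = {p. indets p \<subseteq> V}"

definition mon_degree :: "('v \<Rightarrow>\<^sub>0 nat) \<Rightarrow> nat" where
  "mon_degree m = (\<Sum>v\<in>Poly_Mapping.keys m. Poly_Mapping.lookup m v)"

text \<open>Total degree; the zero polynomial gets degree 0.\<close>

definition total_degree :: "'v rpoly \<Rightarrow> nat" where
  "total_degree p = Max (insert 0 (mon_degree ` Poly_Mapping.keys p))"

definition eval_poly :: "('v \<Rightarrow> real) \<Rightarrow> 'v rpoly \<Rightarrow> real" where
  "eval_poly a p = (\<Sum>m\<in>Poly_Mapping.keys p.
     Poly_Mapping.lookup p m * (\<Prod>v\<in>Poly_Mapping.keys m. a v ^ Poly_Mapping.lookup m v))"

definition subst_poly :: "('v \<Rightarrow> 'w rpoly) \<Rightarrow> 'v rpoly \<Rightarrow> 'w rpoly" where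
  "subst_poly s p = (\<Sum>m\<in>Poly_Mapping.keys p.
     const_poly (Poly_Mapping.lookup p m) * (\<Prod>v\<in>Poly_Mapping.keys m. s v ^ Poly_Mapping.lookup m v))"

text \<open>
  Formal partial derivative. For monomials not containing \<open>v\<close> the coefficient
  \<open>lookup m v\<close> is 0, so the truncated subtraction of exponents is harmless.
\<close>

definition partial_deriv :: "'v \<Rightarrow> 'v rpoly \<Rightarrow> 'v rpoly" where
  "partial_deriv v p = (\<Sum>m\<in>Poly_Mapping.keys p.
     Poly_Mapping.single (m - Poly_Mapping.single v 1)
       (Poly_Mapping.lookup p m * real (Poly_Mapping.lookup m v)))"

text \<open>
  The ideal of the ring \<open>poly_ring V\<close> generated by \<open>G \<subseteq> poly_ring V\<close>: the cofactors are
  required to lie in \<open>poly_ring V\<close> too.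
\<close>

definition ideal_gen :: "'v set \<Rightarrow> 'v rpoly set \<Rightarrow> 'v rpoly set" where
  "ideal_gen V G = {p. \<exists>A c. finite A \<and> A \<subseteq> G \<and> (\<forall>g\<in>A. c g \<in> poly_ring V) \<and>
     p = (\<Sum>g\<in>A. c g * g)}"

definition sos_mod :: "'v set \<Rightarrow> nat \<Rightarrow> 'v rpoly set \<Rightarrow> 'v rpoly \<Rightarrow> bool" where
  "sos_mod V t I p \<longleftrightarrow> (\<exists>(m::nat) q.
     (\<forall>r\<in>{1..m}. q r \<in> poly_ring V \<and> total_degree (q r) \<le> t) \<and>
     p - (\<Sum>r=1..m. (q r)\<^sup>2) \<in> I)"

text \<open>
  The ground set is \<open>{1..n}\<close>; a set function is a function on \<open>nat set\<close> of which only the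
  values on subsets of \<open>{1..n}\<close> matter, and \<open>x\<^sub>i\<close> is the variable with index \<open>i\<close>.
\<close>

definition is_mle :: "nat \<Rightarrow> (nat set \<Rightarrow> real) \<Rightarrow> nat rpoly \<Rightarrow> bool" where
  "is_mle n f F \<longleftrightarrow>
     F \<in> poly_ring {1..n} \<and>
     (\<forall>m\<in>Poly_Mapping.keys F. \<forall>i. Poly_Mapping.lookup m i \<le> 1) \<and>
     (\<forall>S\<subseteq>{1..n}. eval_poly (\<lambda>i. if i \<in> S then 1 else 0) F = f S)"

definition mle :: "nat \<Rightarrow> (nat set \<Rightarrow> real) \<Rightarrow> nat rpoly" where
  "mle n f = (THE F. is_mle n f F)"

text \<open>
  Existence and uniqueness of the multilinear extension, so that the definite description in
  \<open>mle\<close> is well defined.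
\<close>

definition sqfree_mon :: "nat set \<Rightarrow> (nat \<Rightarrow>\<^sub>0 nat)" where
  "sqfree_mon T = (\<Sum>i\<in>T. Poly_Mapping.single i 1)"

lemma lookup_sqfree_mon:
  "finite T \<Longrightarrow> Poly_Mapping.lookup (sqfree_mon T) i = (if i \<in> T then 1 else 0)"
  by (simp add: sqfree_mon_def lookup_sum lookup_single when_def)

lemma keys_sqfree_mon: "finite T \<Longrightarrow> Poly_Mapping.keys (sqfree_mon T) = T"
  by (auto simp: in_keys_iff lookup_sqfree_mon split: if_splits)

lemma inj_sqfree_mon: "finite T \<Longrightarrow> finite U \<Longrightarrow> sqfree_mon T = sqfree_mon U \<longleftrightarrow> T = U"
  by (metis keys_sqfree_mon)

lemma keys_multilinear:
  assumes "F \<in> poly_ring {1..n}"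
    and "\<forall>m\<in>Poly_Mapping.keys F. \<forall>i. Poly_Mapping.lookup m i \<le> 1"
  shows "Poly_Mapping.keys F \<subseteq> sqfree_mon ` Pow {1..n}"
proof
  fix m assume m: "m \<in> Poly_Mapping.keys F"
  have sub: "Poly_Mapping.keys m \<subseteq> {1..n}"
    using assms(1) m by (auto simp: poly_ring_def indets_def)
  have "m = sqfree_mon (Poly_Mapping.keys m)"
  proof (rule poly_mapping_eqI)
    fix i
    have "Poly_Mapping.lookup m i \<le> 1" using assms(2) m by blast
    then show "Poly_Mapping.lookup m i = Poly_Mapping.lookup (sqfree_mon (Poly_Mapping.keys m)) i"
      by (cases "Poly_Mapping.lookup m i") (auto simp: lookup_sqfree_mon in_keys_iff)
  qed
  then show "m \<in> sqfree_mon ` Pow {1..n}" using sub by blast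
qed

lemma eval_multilinear:
  assumes keys: "Poly_Mapping.keys F \<subseteq> sqfree_mon ` Pow {1..n}" and S: "S \<subseteq> {1..n}"
  shows "eval_poly (\<lambda>i. if i \<in> S then 1 else 0) F
    = (\<Sum>T\<in>Pow S. Poly_Mapping.lookup F (sqfree_mon T))"
proof -
  have fin: "finite T" if "T \<in> Pow {1..n}" for T
    using that finite_subset by auto
  let ?e = "\<lambda>m. Poly_Mapping.lookup F m *
    (\<Prod>v\<in>Poly_Mapping.keys m. (if v \<in> S then 1 else 0 :: real) ^ Poly_Mapping.lookup m v)"
  have e: "?e (sqfree_mon T) = (if T \<subseteq> S then Poly_Mapping.lookup F (sqfree_mon T) else 0)"
    if "T \<in> Pow {1..n}" for T
  proof (cases "T \<subseteq> S")
    case True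
    then have "(\<Prod>v\<in>T. (if v \<in> S then 1 else 0 :: real) ^ Poly_Mapping.lookup (sqfree_mon T) v) = 1"
      by (intro prod.neutral) auto
    then show ?thesis using True fin[OF that] by (simp add: keys_sqfree_mon)
  next
    case False
    then obtain v where "v \<in> T" "v \<notin> S" by blast
    then have "(\<Prod>v\<in>T. (if v \<in> S then 1 else 0 :: real) ^ Poly_Mapping.lookup (sqfree_mon T) v) = 0"
      using fin[OF that] by (intro prod_zero bexI[of _ v]) (auto simp: lookup_sqfree_mon)
    then show ?thesis using False fin[OF that] by (simp add: keys_sqfree_mon)
  qed
  have inj: "inj_on sqfree_mon (Pow {1..n})"
    using fin by (auto simp: inj_on_def inj_sqfree_mon)
  have "eval_poly (\<lambda>i. if i \<in> S then 1 else 0) F = (\<Sum>m\<in>sqfree_mon ` Pow {1..n}. ?e m)"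
    unfolding eval_poly_def using keys
    by (intro sum.mono_neutral_left) (auto simp: in_keys_iff)
  also have "\<dots> = (\<Sum>T\<in>Pow {1..n}. ?e (sqfree_mon T))"
    using inj by (simp add: sum.reindex)
  also have "\<dots> = (\<Sum>T\<in>Pow {1..n}. if T \<subseteq> S then Poly_Mapping.lookup F (sqfree_mon T) else 0)"
    using e by (intro sum.cong) auto
  also have "\<dots> = (\<Sum>T\<in>Pow S. if T \<subseteq> S then Poly_Mapping.lookup F (sqfree_mon T) else 0)"
    using S by (intro sum.mono_neutral_right) auto
  finally show ?thesis by simp
qed

lemma subset_sum_exists:
  fixes f :: "nat set \<Rightarrow> real"
  shows "\<exists>c. \<forall>S\<subseteq>{1..n}. (\<Sum>T\<in>Pow S. c T) = f S"
proof (induction n arbitrary: f)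
  case 0
  show ?case by (intro exI[of _ f]) simp
next
  case (Suc n)
  obtain c where c: "\<forall>S\<subseteq>{1..n}. (\<Sum>T\<in>Pow S. c T) = f S" using Suc by blast
  obtain d where d: "\<forall>S\<subseteq>{1..n}. (\<Sum>T\<in>Pow S. d T) = f (insert (Suc n) S) - f S"
    using Suc[of "\<lambda>S. f (insert (Suc n) S) - f S"] by blast
  let ?b = "\<lambda>T. if Suc n \<in> T then d (T - {Suc n}) else c T"
  have "(\<Sum>T\<in>Pow S. ?b T) = f S" if S: "S \<subseteq> {1..Suc n}" for S
  proof (cases "Suc n \<in> S")
    case False
    then have sub: "S \<subseteq> {1..n}" using S by (force simp: le_Suc_eq)
    have "(\<Sum>T\<in>Pow S. ?b T) = (\<Sum>T\<in>Pow S. c T)"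
      using False by (intro sum.cong) auto
    then show ?thesis using c sub by simp
  next
    case True
    define R where "R = S - {Suc n}"
    have R: "S = insert (Suc n) R" "Suc n \<notin> R" "R \<subseteq> {1..n}"
      using True S by (auto simp: R_def subset_iff le_Suc_eq)
    have inj: "inj_on (insert (Suc n)) (Pow R)"
    proof (rule inj_onI)
      fix A B assume "A \<in> Pow R" "B \<in> Pow R" and eq: "insert (Suc n) A = insert (Suc n) B"
      then have "Suc n \<notin> A" "Suc n \<notin> B" using R(2) by auto
      then show "A = B" using eq by (simp add: insert_ident)
    qed
    have fin: "finite R" using R(3) finite_subset by blast
    have "(\<Sum>T\<in>Pow S. ?b T) = (\<Sum>T\<in>Pow R. ?b T) + (\<Sum>T\<in>insert (Suc n) ` Pow R. ?b T)"
      unfolding R(1) Pow_insert using R(2) fin by (intro sum.union_disjoint) auto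
    also have "(\<Sum>T\<in>Pow R. ?b T) = (\<Sum>T\<in>Pow R. c T)"
      using R(2) by (intro sum.cong) auto
    also have "(\<Sum>T\<in>insert (Suc n) ` Pow R. ?b T) = (\<Sum>T\<in>Pow R. ?b (insert (Suc n) T))"
      by (intro sum.reindex_cong[OF inj refl refl])
    also have "\<dots> = (\<Sum>T\<in>Pow R. d T)"
    proof (intro sum.cong refl)
      fix T assume "T \<in> Pow R"
      then have "insert (Suc n) T - {Suc n} = T" using R(2) by blast
      then show "?b (insert (Suc n) T) = d T" by simp
    qed
    finally show ?thesis using c d R by simp
  qed
  then show ?case by blast
qed

lemma mle_exists: "\<exists>F. is_mle n f F"
proof -
  obtain c where c: "\<forall>S\<subseteq>{1..n}. (\<Sum>T\<in>Pow S. c T) = f S" using subset_sum_exists by blast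
  define F where "F = (\<Sum>T\<in>Pow {1..n}. Poly_Mapping.single (sqfree_mon T) (c T))"
  have fin: "finite T" if "T \<subseteq> {1..n}" for T
    using that finite_subset by blast
  have keys: "Poly_Mapping.keys F \<subseteq> sqfree_mon ` Pow {1..n}"
    unfolding F_def by (rule order.trans[OF keys_sum]) (auto split: if_splits)
  have lookup: "Poly_Mapping.lookup F (sqfree_mon T) = c T" if "T \<subseteq> {1..n}" for T
  proof -
    have "Poly_Mapping.lookup F (sqfree_mon T) = (\<Sum>U\<in>Pow {1..n}. if U = T then c U else 0)"
      unfolding F_def lookup_sum using that fin
      by (intro sum.cong refl) (auto simp: lookup_single when_def inj_sqfree_mon)
    then show ?thesis using that by simp
  qed
  have mons: "Poly_Mapping.keys m \<subseteq> {1..n} \<and> Poly_Mapping.lookup m i \<le> 1"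
    if m: "m \<in> Poly_Mapping.keys F" for m i
  proof -
    obtain T where "m = sqfree_mon T" "T \<subseteq> {1..n}" using keys m by blast
    then show ?thesis using fin[of T] by (simp add: keys_sqfree_mon lookup_sqfree_mon)
  qed
  have "F \<in> poly_ring {1..n}"
    unfolding poly_ring_def indets_def using mons by blast
  moreover have "\<forall>m\<in>Poly_Mapping.keys F. \<forall>i. Poly_Mapping.lookup m i \<le> 1"
    using mons by blast
  moreover have "eval_poly (\<lambda>i. if i \<in> S then 1 else 0) F = f S" if "S \<subseteq> {1..n}" for S
  proof -
    have "(\<Sum>T\<in>Pow S. Poly_Mapping.lookup F (sqfree_mon T)) = (\<Sum>T\<in>Pow S. c T)"
      using that by (intro sum.cong refl lookup) auto
    then show ?thesis using eval_multilinear[OF keys that] c that by simp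
  qed
  ultimately show ?thesis unfolding is_mle_def by blast
qed

lemma mle_unique:
  assumes F: "is_mle n f F" and G: "is_mle n f G"
  shows "F = G"
proof -
  have kF: "Poly_Mapping.keys F \<subseteq> sqfree_mon ` Pow {1..n}"
    and kG: "Poly_Mapping.keys G \<subseteq> sqfree_mon ` Pow {1..n}"
    by (rule keys_multilinear; use F G in \<open>simp add: is_mle_def\<close>)+
  have eq: "Poly_Mapping.lookup F (sqfree_mon S) = Poly_Mapping.lookup G (sqfree_mon S)"
    if "S \<subseteq> {1..n}" for S
    using finite_subset[OF that finite_atLeastAtMost] that
  proof (induction S rule: finite_psubset_induct)
    case (psubset S)
    have split: "(\<Sum>T\<in>Pow S. h T) = h S + (\<Sum>T\<in>Pow S - {S}. h T)" for h :: "nat set \<Rightarrow> real"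
      using psubset.hyps by (intro sum.remove) auto
    have "(\<Sum>T\<in>Pow S. Poly_Mapping.lookup F (sqfree_mon T))
        = (\<Sum>T\<in>Pow S. Poly_Mapping.lookup G (sqfree_mon T))"
      using F G psubset.prems
      by (simp add: is_mle_def eval_multilinear[OF kF, symmetric] eval_multilinear[OF kG, symmetric])
    moreover have "(\<Sum>T\<in>Pow S - {S}. Poly_Mapping.lookup F (sqfree_mon T))
        = (\<Sum>T\<in>Pow S - {S}. Poly_Mapping.lookup G (sqfree_mon T))"
      using psubset.prems by (intro sum.cong refl psubset.IH) auto
    ultimately show ?case unfolding split by simp
  qed
  show ?thesis
  proof (rule poly_mapping_eqI)
    fix m
    show "Poly_Mapping.lookup F m = Poly_Mapping.lookup G m"
    proof (cases "m \<in> sqfree_mon ` Pow {1..n}")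
      case True
      then show ?thesis using eq by blast
    next
      case False
      then have "m \<notin> Poly_Mapping.keys F" "m \<notin> Poly_Mapping.keys G" using kF kG by blast+
      then show ?thesis by (simp add: in_keys_iff)
    qed
  qed
qed

lemma is_mle_mle: "is_mle n f (mle n f)"
  unfolding mle_def using mle_exists mle_unique by (metis theI)

definition I2 :: "nat set \<Rightarrow> nat rpoly set" where
  "I2 V = ideal_gen V ((\<lambda>k. (var_poly k)\<^sup>2 - var_poly k) ` V)"

definition sos_submodular :: "nat \<Rightarrow> nat \<Rightarrow> (nat set \<Rightarrow> real) \<Rightarrow> bool" where
  "sos_submodular t n f \<longleftrightarrow> (\<forall>i\<in>{1..n}. \<forall>j\<in>{1..n}. i \<noteq> j \<longrightarrow>
     sos_mod ({1..n} - {i, j}) t (I2 ({1..n} - {i, j}))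
       (- partial_deriv i (partial_deriv j (mle n f))))"

datatype xyvar = xvar nat | yvar nat

abbreviation x_poly :: "nat \<Rightarrow> xyvar rpoly" where
  "x_poly i \<equiv> var_poly (xvar i)"

abbreviation y_poly :: "nat \<Rightarrow> xyvar rpoly" where
  "y_poly i \<equiv> var_poly (yvar i)"

definition xyvars :: "nat \<Rightarrow> xyvar set" where
  "xyvars n = xvar ` {1..n} \<union> yvar ` {1..n}"

definition I1 :: "nat \<Rightarrow> xyvar rpoly set" where
  "I1 n = ideal_gen (xyvars n)
     (\<Union>i\<in>{1..n}. {(x_poly i)\<^sup>2 - x_poly i, x_poly i * y_poly i - x_poly i, (y_poly i)\<^sup>2 - y_poly i})"

definition H1 :: "nat \<Rightarrow> nat rpoly \<Rightarrow> xyvar rpoly" where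
  "H1 n F = subst_poly x_poly F - subst_poly y_poly F
     + (\<Sum>i=1..n. (y_poly i - x_poly i) * subst_poly x_poly (partial_deriv i F))"

end

theory Submission imports Defs
begin

text \<open>
  Both ideals are vanishing ideals of finite point sets: \<open>I2 V\<close> of the cube over \<open>V\<close>, and \<open>I1 n\<close> of
  the set of pairs \<open>(1\<^sub>S, 1\<^sub>T)\<close> with \<open>S \<subseteq> T\<close> (lemmas \<open>I2_iff_vanishes\<close>, \<open>I1_iff_vanishes\<close>). Hence being
  \<open>t\<close>-sos modulo either of them is a statement about values, with the degree bound as the only
  remaining algebraic content. At such a pair, \<open>H\<^sub>1\<close> takes the value
  \<open>f S - f T + (\<Sum>i\<in>T - S. f (S \<union> {i}) - f S)\<close>, and at \<open>1\<^sub>S\<close> with \<open>i, j \<notin> S\<close> the second derivative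
  is the second difference of \<open>f\<close>.

  If \<open>f\<close> is \<open>t\<close>-sos-submodular, add the elements of \<open>T - S\<close> to \<open>S\<close> in increasing order and telescope
  twice. This writes \<open>H\<^sub>1\<close> as the sum over \<open>l < k\<close> of
  \<open>(y\<^sub>k - x\<^sub>k) (y\<^sub>l - x\<^sub>l) (- \<partial>\<^sub>l \<partial>\<^sub>k F)(y\<^sub>1, \<dots>, y\<^sub>l\<^sub>-\<^sub>1, x\<^sub>l, \<dots>, x\<^sub>n)\<close>. The two linear factors take
  values 0 and 1 only, so they may be squared, and each square of a polynomial of degree at most \<open>t\<close>
  in a certificate of the second derivative turns into the square of one of degree at most \<open>t + 2\<close>.

  Conversely, let \<open>H\<^sub>1\<close> agree with \<open>\<Sum>r. q\<^sub>r\<^sup>2\<close> on the pairs. Its value at \<open>(S, S \<union> {i, j})\<close> is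
  \<open>- \<partial>\<^sub>i \<partial>\<^sub>j F\<close> at \<open>1\<^sub>S\<close>, but restricting the \<open>q\<^sub>r\<close> to these points does not lower their degree. What
  helps is that \<open>H\<^sub>1\<close>, and therefore every \<open>q\<^sub>r\<close>, vanishes at \<open>(S, S)\<close>, \<open>(S, S \<union> {i})\<close> and
  \<open>(S, S \<union> {j})\<close>. So the restriction of \<open>q\<^sub>r\<close> equals its mixed difference in \<open>y\<^sub>i\<close> and \<open>y\<^sub>j\<close>, to
  which only monomials divisible by \<open>y\<^sub>i y\<^sub>j\<close> contribute, and these lose both factors: the mixed
  difference is a polynomial of degree at most \<open>t\<close> (\<open>eval_mixed_difference\<close>,
  \<open>mixed_difference_upto\<close>).
\<close>

section \<open>Evaluation of polynomials\<close>

definition mon_eval :: "('v \<Rightarrow> real) \<Rightarrow> ('v \<Rightarrow>\<^sub>0 nat) \<Rightarrow> real" where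
  "mon_eval a m = (\<Prod>v\<in>Poly_Mapping.keys m. a v ^ Poly_Mapping.lookup m v)"

lemma mon_eval_superset:
  assumes "finite A" "Poly_Mapping.keys m \<subseteq> A"
  shows "mon_eval a m = (\<Prod>v\<in>A. a v ^ Poly_Mapping.lookup m v)"
  unfolding mon_eval_def using assms
  by (intro prod.mono_neutral_left) (auto simp: in_keys_iff)

lemma mon_eval_add: "mon_eval a (m + m') = mon_eval a m * mon_eval a m'"
proof -
  let ?A = "Poly_Mapping.keys m \<union> Poly_Mapping.keys m'"
  have "mon_eval a (m + m') = (\<Prod>v\<in>?A. a v ^ Poly_Mapping.lookup (m + m') v)"
    by (intro mon_eval_superset) (use keys_add[of m m'] in auto)
  also have "\<dots> = (\<Prod>v\<in>?A. a v ^ Poly_Mapping.lookup m v) * (\<Prod>v\<in>?A. a v ^ Poly_Mapping.lookup m' v)"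
    by (simp add: lookup_add power_add prod.distrib)
  also have "\<dots> = mon_eval a m * mon_eval a m'"
    by (simp add: mon_eval_superset[of ?A])
  finally show ?thesis .
qed

lemma eval_poly_superset:
  assumes "finite A" "Poly_Mapping.keys p \<subseteq> A"
  shows "eval_poly a p = (\<Sum>m\<in>A. Poly_Mapping.lookup p m * mon_eval a m)"
  unfolding eval_poly_def mon_eval_def[symmetric] using assms
  by (intro sum.mono_neutral_left) (auto simp: in_keys_iff)

lemma eval_poly_single: "eval_poly a (Poly_Mapping.single m c) = c * mon_eval a m"
  by (subst eval_poly_superset[of "{m}"]) auto

lemma eval_poly_0 [simp]: "eval_poly a 0 = 0"
  by (simp add: eval_poly_def)

lemma eval_poly_add [simp]: "eval_poly a (p + q) = eval_poly a p + eval_poly a q"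
proof -
  let ?A = "Poly_Mapping.keys p \<union> Poly_Mapping.keys q"
  have "eval_poly a (p + q) = (\<Sum>m\<in>?A. Poly_Mapping.lookup (p + q) m * mon_eval a m)"
    by (intro eval_poly_superset) (use keys_add[of p q] in auto)
  also have "\<dots> = eval_poly a p + eval_poly a q"
    by (simp add: eval_poly_superset[of ?A] lookup_add distrib_right sum.distrib)
  finally show ?thesis .
qed

lemma eval_poly_diff [simp]: "eval_poly a (p - q) = eval_poly a p - eval_poly a q"
  using eval_poly_add[of a "p - q" q] by simp

lemma eval_poly_uminus [simp]: "eval_poly a (- p) = - eval_poly a p"
  using eval_poly_diff[of a 0 p] by simp

lemma eval_poly_sum [simp]: "eval_poly a (\<Sum>i\<in>A. p i) = (\<Sum>i\<in>A. eval_poly a (p i))"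
  by (induction A rule: infinite_finite_induct) auto

lemma poly_eq_sum_single:
  fixes p :: "'a \<Rightarrow>\<^sub>0 'b::comm_monoid_add"
  shows "p = (\<Sum>m\<in>Poly_Mapping.keys p. Poly_Mapping.single m (Poly_Mapping.lookup p m))"
  by (rule poly_mapping_eqI)
    (simp add: lookup_sum lookup_single when_def in_keys_iff)

lemma eval_poly_mult [simp]: "eval_poly a (p * q) = eval_poly a p * eval_poly a q"
proof -
  have "p * q = (\<Sum>m\<in>Poly_Mapping.keys p. \<Sum>m'\<in>Poly_Mapping.keys q.
      Poly_Mapping.single (m + m') (Poly_Mapping.lookup p m * Poly_Mapping.lookup q m'))"
    by (subst poly_eq_sum_single[of p], subst poly_eq_sum_single[of q])
      (simp add: sum_product mult_single)
  then show ?thesis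
    by (simp add: eval_poly_single mon_eval_add eval_poly_def[of a p] eval_poly_def[of a q]
        sum_product mon_eval_def[symmetric] algebra_simps)
qed

lemma eval_poly_const [simp]: "eval_poly a (const_poly c) = c"
  by (simp add: const_poly_def eval_poly_single mon_eval_def)

lemma eval_poly_1 [simp]: "eval_poly a 1 = 1"
  using eval_poly_const[of a 1] by (simp add: const_poly_def)

lemma eval_poly_var [simp]: "eval_poly a (var_poly v) = a v"
  by (simp add: var_poly_def eval_poly_single mon_eval_def)

lemma eval_poly_power [simp]: "eval_poly a (p ^ k) = eval_poly a p ^ k"
  by (induction k) auto

lemma eval_poly_prod [simp]: "eval_poly a (\<Prod>i\<in>A. p i) = (\<Prod>i\<in>A. eval_poly a (p i))"
  by (induction A rule: infinite_finite_induct) auto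

lemma eval_poly_subst [simp]: "eval_poly a (subst_poly s p) = eval_poly (\<lambda>v. eval_poly a (s v)) p"
  by (simp add: subst_poly_def eval_poly_def[of _ p])

text \<open>
  A monomial with exponent 0 in \<open>v\<close> contributes 0 to both sides, and one with exponent 1 contributes
  its cofactor. Both values of \<open>v\<close> on the right are 0 or 1, so vertices of the cube stay vertices.
\<close>

lemma eval_partial_deriv:
  assumes "\<forall>m\<in>Poly_Mapping.keys p. Poly_Mapping.lookup m v \<le> 1"
  shows "eval_poly a (partial_deriv v p) = eval_poly (a(v := 1)) p - eval_poly (a(v := 0)) p"
proof -
  have "real (Poly_Mapping.lookup m v) * mon_eval a (m - Poly_Mapping.single v 1)
      = mon_eval (a(v := 1)) m - mon_eval (a(v := 0)) m"
    if m: "m \<in> Poly_Mapping.keys p" for m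
  proof -
    let ?m = "m - Poly_Mapping.single v 1"
    let ?K = "Poly_Mapping.keys m - {v}"
    have split: "mon_eval b m' = b v ^ Poly_Mapping.lookup m' v * (\<Prod>w\<in>?K. b w ^ Poly_Mapping.lookup m' w)"
      if "Poly_Mapping.keys m' \<subseteq> insert v ?K" for b m'
      using that by (subst mon_eval_superset[of "insert v ?K"]) (simp_all add: prod.insert_remove)
    have Km: "Poly_Mapping.keys m \<subseteq> insert v ?K" by auto
    have K: "Poly_Mapping.keys ?m \<subseteq> insert v ?K"
      by (auto simp: in_keys_iff lookup_minus)
    have eq: "(\<Prod>w\<in>?K. (a(v := c)) w ^ Poly_Mapping.lookup m w)
        = (\<Prod>w\<in>?K. a w ^ Poly_Mapping.lookup ?m w)" for c
      by (intro prod.cong) (auto simp: lookup_minus lookup_single)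
    have "Poly_Mapping.lookup m v = 0 \<or> Poly_Mapping.lookup m v = 1"
      using assms m by (auto simp: le_Suc_eq)
    then show ?thesis
      unfolding split[OF K] split[OF Km] eq
      by (auto simp: lookup_minus)
  qed
  then have "eval_poly a (partial_deriv v p) = (\<Sum>m\<in>Poly_Mapping.keys p.
      Poly_Mapping.lookup p m * (mon_eval (a(v := 1)) m - mon_eval (a(v := 0)) m))"
    by (simp add: partial_deriv_def eval_poly_single mult.assoc)
  then show ?thesis
    by (simp only: eval_poly_superset[OF finite_keys order.refl] right_diff_distrib sum_subtractf)
qed

section \<open>Polynomials of bounded degree\<close>

definition poly_ring_upto :: "'v set \<Rightarrow> nat \<Rightarrow> 'v rpoly set" where
  "poly_ring_upto V d = {p \<in> poly_ring V. total_degree p \<le> d}"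

lemma poly_ring_upto_iff:
  "p \<in> poly_ring_upto V d \<longleftrightarrow>
     (\<forall>m\<in>Poly_Mapping.keys p. Poly_Mapping.keys m \<subseteq> V \<and> mon_degree m \<le> d)"
  by (auto simp: poly_ring_upto_def poly_ring_def indets_def total_degree_def)

lemma poly_ring_uptoD: "p \<in> poly_ring_upto V d \<Longrightarrow> p \<in> poly_ring V"
  by (simp add: poly_ring_upto_def)

lemma poly_ring_imp_upto: "p \<in> poly_ring V \<Longrightarrow> p \<in> poly_ring_upto V (total_degree p)"
  by (simp add: poly_ring_upto_def)

lemma poly_ring_upto_mono: "p \<in> poly_ring_upto V d \<Longrightarrow> d \<le> e \<Longrightarrow> p \<in> poly_ring_upto V e"
  by (auto simp: poly_ring_upto_def)

lemma mon_degree_superset: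
  assumes "finite A" "Poly_Mapping.keys m \<subseteq> A"
  shows "mon_degree m = (\<Sum>v\<in>A. Poly_Mapping.lookup m v)"
  unfolding mon_degree_def using assms
  by (intro sum.mono_neutral_left) (auto simp: in_keys_iff)

lemma mon_degree_add: "mon_degree (m + m') = mon_degree m + mon_degree m'"
proof -
  let ?A = "Poly_Mapping.keys m \<union> Poly_Mapping.keys m'"
  have "mon_degree (m + m') = (\<Sum>v\<in>?A. Poly_Mapping.lookup (m + m') v)"
    by (intro mon_degree_superset) (use keys_add[of m m'] in auto)
  then show ?thesis
    by (simp add: mon_degree_superset[of ?A] lookup_add sum.distrib)
qed

lemma poly_ring_upto_0: "0 \<in> poly_ring_upto V d"
  by (simp add: poly_ring_upto_iff)

lemma poly_ring_upto_const: "const_poly c \<in> poly_ring_upto V d"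
  by (auto simp: poly_ring_upto_iff const_poly_def mon_degree_def)

lemma poly_ring_upto_1: "1 \<in> poly_ring_upto V d"
  using poly_ring_upto_const[of 1] by (simp add: const_poly_def)

lemma poly_ring_upto_var: "v \<in> V \<Longrightarrow> 1 \<le> d \<Longrightarrow> var_poly v \<in> poly_ring_upto V d"
  by (auto simp: poly_ring_upto_iff var_poly_def mon_degree_def)

lemma poly_ring_upto_add:
  "p \<in> poly_ring_upto V d \<Longrightarrow> q \<in> poly_ring_upto V d \<Longrightarrow> p + q \<in> poly_ring_upto V d"
  using keys_add[of p q] by (fastforce simp: poly_ring_upto_iff)

lemma poly_ring_upto_uminus: "p \<in> poly_ring_upto V d \<Longrightarrow> - p \<in> poly_ring_upto V d"
  by (simp add: poly_ring_upto_iff in_keys_iff)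

lemma poly_ring_upto_diff:
  "p \<in> poly_ring_upto V d \<Longrightarrow> q \<in> poly_ring_upto V d \<Longrightarrow> p - q \<in> poly_ring_upto V d"
  using poly_ring_upto_add[OF _ poly_ring_upto_uminus, of p V d q] by simp

lemma poly_ring_upto_sum:
  "(\<And>i. i \<in> A \<Longrightarrow> p i \<in> poly_ring_upto V d) \<Longrightarrow> (\<Sum>i\<in>A. p i) \<in> poly_ring_upto V d"
  by (induction A rule: infinite_finite_induct) (auto intro: poly_ring_upto_add poly_ring_upto_0)

lemma poly_ring_upto_mult:
  assumes "p \<in> poly_ring_upto V d" "q \<in> poly_ring_upto V e"
  shows "p * q \<in> poly_ring_upto V (d + e)"
  unfolding poly_ring_upto_iff
proof
  fix m assume "m \<in> Poly_Mapping.keys (p * q)"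
  then obtain m1 m2 where m: "m = m1 + m2" "m1 \<in> Poly_Mapping.keys p" "m2 \<in> Poly_Mapping.keys q"
    using keys_mult[of p q] by blast
  then show "Poly_Mapping.keys m \<subseteq> V \<and> mon_degree m \<le> d + e"
    using assms keys_add[of m1 m2] by (fastforce simp: poly_ring_upto_iff mon_degree_add intro: add_mono)
qed

lemma poly_ring_upto_power: "p \<in> poly_ring_upto V d \<Longrightarrow> p ^ k \<in> poly_ring_upto V (k * d)"
  by (induction k) (auto intro: poly_ring_upto_1 poly_ring_upto_mult)

lemma poly_ring_upto_prod:
  "(\<And>i. i \<in> A \<Longrightarrow> p i \<in> poly_ring_upto V (d i)) \<Longrightarrow> (\<Prod>i\<in>A. p i) \<in> poly_ring_upto V (\<Sum>i\<in>A. d i)"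
  by (induction A rule: infinite_finite_induct) (auto intro: poly_ring_upto_1 poly_ring_upto_mult)

lemma poly_ring_upto_subst:
  assumes p: "p \<in> poly_ring_upto V d" and s: "\<And>v. v \<in> V \<Longrightarrow> s v \<in> poly_ring_upto W 1"
  shows "subst_poly s p \<in> poly_ring_upto W d"
  unfolding subst_poly_def
proof (rule poly_ring_upto_sum)
  fix m assume m: "m \<in> Poly_Mapping.keys p"
  have "(\<Prod>v\<in>Poly_Mapping.keys m. s v ^ Poly_Mapping.lookup m v) \<in> poly_ring_upto W (mon_degree m)"
    unfolding mon_degree_def
  proof (rule poly_ring_upto_prod)
    fix v assume "v \<in> Poly_Mapping.keys m"
    then show "s v ^ Poly_Mapping.lookup m v \<in> poly_ring_upto W (Poly_Mapping.lookup m v)"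
      using poly_ring_upto_power[OF s, of v "Poly_Mapping.lookup m v"] p m
      by (auto simp: poly_ring_upto_iff)
  qed
  then have "const_poly (Poly_Mapping.lookup p m) *
      (\<Prod>v\<in>Poly_Mapping.keys m. s v ^ Poly_Mapping.lookup m v) \<in> poly_ring_upto W (0 + mon_degree m)"
    by (intro poly_ring_upto_mult poly_ring_upto_const)
  then show "const_poly (Poly_Mapping.lookup p m) *
      (\<Prod>v\<in>Poly_Mapping.keys m. s v ^ Poly_Mapping.lookup m v) \<in> poly_ring_upto W d"
    by (rule poly_ring_upto_mono) (use p m in \<open>simp add: poly_ring_upto_iff\<close>)
qed

lemma poly_ring_0: "0 \<in> poly_ring V"
  by (rule poly_ring_uptoD[OF poly_ring_upto_0])

lemma poly_ring_const: "const_poly c \<in> poly_ring V"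
  by (rule poly_ring_uptoD[OF poly_ring_upto_const])

lemma poly_ring_1: "1 \<in> poly_ring V"
  by (rule poly_ring_uptoD[OF poly_ring_upto_1])

lemma poly_ring_var: "v \<in> V \<Longrightarrow> var_poly v \<in> poly_ring V"
  by (rule poly_ring_uptoD[OF poly_ring_upto_var[OF _ order.refl]])

lemma poly_ring_add: "p \<in> poly_ring V \<Longrightarrow> q \<in> poly_ring V \<Longrightarrow> p + q \<in> poly_ring V"
  unfolding poly_ring_def indets_def using keys_add[of p q] by blast

lemma poly_ring_uminus: "p \<in> poly_ring V \<Longrightarrow> - p \<in> poly_ring V"
  by (rule poly_ring_uptoD[OF poly_ring_upto_uminus[OF poly_ring_imp_upto]])

lemma poly_ring_diff: "p \<in> poly_ring V \<Longrightarrow> q \<in> poly_ring V \<Longrightarrow> p - q \<in> poly_ring V"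
  using poly_ring_add[OF _ poly_ring_uminus, of p V q] by simp

lemma poly_ring_mult: "p \<in> poly_ring V \<Longrightarrow> q \<in> poly_ring V \<Longrightarrow> p * q \<in> poly_ring V"
  by (rule poly_ring_uptoD[OF poly_ring_upto_mult[OF poly_ring_imp_upto poly_ring_imp_upto]])

lemma poly_ring_power: "p \<in> poly_ring V \<Longrightarrow> p ^ k \<in> poly_ring V"
  by (rule poly_ring_uptoD[OF poly_ring_upto_power[OF poly_ring_imp_upto]])

lemma poly_ring_sum: "(\<And>i. i \<in> A \<Longrightarrow> p i \<in> poly_ring V) \<Longrightarrow> (\<Sum>i\<in>A. p i) \<in> poly_ring V"
  by (induction A rule: infinite_finite_induct) (auto intro: poly_ring_add poly_ring_0)

lemma poly_ring_prod: "(\<And>i. i \<in> A \<Longrightarrow> p i \<in> poly_ring V) \<Longrightarrow> (\<Prod>i\<in>A. p i) \<in> poly_ring V"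
  by (induction A rule: infinite_finite_induct) (auto intro: poly_ring_mult poly_ring_1)

lemmas poly_ring_intros = poly_ring_0 poly_ring_1 poly_ring_const poly_ring_var poly_ring_add
  poly_ring_uminus poly_ring_diff poly_ring_mult poly_ring_power poly_ring_sum poly_ring_prod

lemma poly_ring_subst:
  "p \<in> poly_ring V \<Longrightarrow> (\<And>v. v \<in> V \<Longrightarrow> s v \<in> poly_ring_upto W 1) \<Longrightarrow> subst_poly s p \<in> poly_ring W"
  by (rule poly_ring_uptoD[OF poly_ring_upto_subst[OF poly_ring_imp_upto]])

lemma var_poly_power: "var_poly v ^ k = Poly_Mapping.single (Poly_Mapping.single v k) 1"
  by (induction k) (simp_all add: var_poly_def mult_single flip: single_add)

lemma prod_single_1:
  "(\<Prod>v\<in>A. Poly_Mapping.single (g v) (1::real)) = Poly_Mapping.single (\<Sum>v\<in>A. g v) 1"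
  by (induction A rule: infinite_finite_induct) (simp_all add: mult_single)

lemma subst_poly_var: "subst_poly var_poly p = p"
proof -
  have "(\<Prod>v\<in>Poly_Mapping.keys m. var_poly v ^ Poly_Mapping.lookup m v) = Poly_Mapping.single m 1"
    for m :: "'a \<Rightarrow>\<^sub>0 nat"
    unfolding var_poly_power prod_single_1 poly_eq_sum_single[of m, symmetric] ..
  then have "subst_poly var_poly p
      = (\<Sum>m\<in>Poly_Mapping.keys p. Poly_Mapping.single m (Poly_Mapping.lookup p m))"
    by (simp add: subst_poly_def const_poly_def mult_single)
  then show ?thesis
    by (simp only: poly_eq_sum_single[of p, symmetric])
qed

text \<open>
  Polynomials over \<open>V\<close> are what constants and variables generate, so that an ideal membership that
  depends on a polynomial need only be checked on these.
\<close>

lemma poly_ring_induct [consumes 1, case_names const var add mult]: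
  assumes p: "p \<in> poly_ring V"
    and const: "\<And>c. P (const_poly c)" and var: "\<And>v. v \<in> V \<Longrightarrow> P (var_poly v)"
    and add: "\<And>p q. p \<in> poly_ring V \<Longrightarrow> q \<in> poly_ring V \<Longrightarrow> P p \<Longrightarrow> P q \<Longrightarrow> P (p + q)"
    and mult: "\<And>p q. p \<in> poly_ring V \<Longrightarrow> q \<in> poly_ring V \<Longrightarrow> P p \<Longrightarrow> P q \<Longrightarrow> P (p * q)"
  shows "P p"
proof -
  let ?Q = "\<lambda>p. p \<in> poly_ring V \<and> P p"
  have Q0: "?Q 0" and Q1: "?Q 1"
    using const[of 0] const[of 1] by (simp_all add: const_poly_def poly_ring_intros)
  have power: "?Q (var_poly v ^ k)" if "v \<in> V" for v k
    using that by (induction k) (auto simp: Q1 intro!: mult var poly_ring_intros)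
  have prod: "?Q (\<Prod>i\<in>A. g i)" if "\<And>i. i \<in> A \<Longrightarrow> ?Q (g i)" for A :: "'a set" and g
    using that by (induction A rule: infinite_finite_induct) (auto simp: Q1 intro!: mult poly_ring_mult)
  have sum: "?Q (\<Sum>i\<in>A. g i)" if "\<And>i. i \<in> A \<Longrightarrow> ?Q (g i)" for A :: "('a \<Rightarrow>\<^sub>0 nat) set" and g
    using that by (induction A rule: infinite_finite_induct) (auto simp: Q0 intro!: add poly_ring_add)
  have "?Q (subst_poly var_poly p)"
    unfolding subst_poly_def
  proof (rule sum)
    fix m assume m: "m \<in> Poly_Mapping.keys p"
    have "?Q (\<Prod>v\<in>Poly_Mapping.keys m. var_poly v ^ Poly_Mapping.lookup m v)"
      by (intro prod power) (use p m in \<open>auto simp: poly_ring_def indets_def\<close>)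
    then show "?Q (const_poly (Poly_Mapping.lookup p m) *
        (\<Prod>v\<in>Poly_Mapping.keys m. var_poly v ^ Poly_Mapping.lookup m v))"
      by (auto intro!: mult const poly_ring_intros)
  qed
  then show ?thesis by (simp add: subst_poly_var)
qed

section \<open>A Nullstellensatz on the Boolean cube\<close>

lemma ideal_gen_0: "0 \<in> ideal_gen V G"
  unfolding ideal_gen_def by (auto intro!: exI[of _ "{}"])

lemma ideal_gen_generator: "g \<in> G \<Longrightarrow> g \<in> ideal_gen V G"
  unfolding ideal_gen_def
  by (auto intro!: exI[of _ "{g}"] exI[of _ "\<lambda>_. 1"] poly_ring_1)

lemma ideal_gen_add:
  assumes "p \<in> ideal_gen V G" "q \<in> ideal_gen V G"
  shows "p + q \<in> ideal_gen V G"
proof -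
  obtain A c where A: "finite A" "A \<subseteq> G" "\<forall>g\<in>A. c g \<in> poly_ring V" "p = (\<Sum>g\<in>A. c g * g)"
    using assms(1) unfolding ideal_gen_def by blast
  obtain B d where B: "finite B" "B \<subseteq> G" "\<forall>g\<in>B. d g \<in> poly_ring V" "q = (\<Sum>g\<in>B. d g * g)"
    using assms(2) unfolding ideal_gen_def by blast
  let ?c = "\<lambda>g. if g \<in> A then c g else 0" and ?d = "\<lambda>g. if g \<in> B then d g else 0"
  have "p = (\<Sum>g\<in>A \<union> B. ?c g * g)"
    unfolding A(4) using A(1) B(1) by (intro sum.mono_neutral_cong_left) auto
  moreover have "q = (\<Sum>g\<in>A \<union> B. ?d g * g)"
    unfolding B(4) using A(1) B(1) by (intro sum.mono_neutral_cong_left) auto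
  ultimately have "p + q = (\<Sum>g\<in>A \<union> B. (?c g + ?d g) * g)"
    by (simp add: distrib_right sum.distrib)
  moreover have "\<forall>g\<in>A \<union> B. ?c g + ?d g \<in> poly_ring V"
    using A(3) B(3) by (auto intro!: poly_ring_intros)
  ultimately show ?thesis
    unfolding ideal_gen_def using A(1,2) B(1,2)
    by (intro CollectI exI[of _ "A \<union> B"] exI[of _ "\<lambda>g. ?c g + ?d g"]) auto
qed

lemma ideal_gen_mult:
  assumes "h \<in> poly_ring V" "p \<in> ideal_gen V G"
  shows "h * p \<in> ideal_gen V G"
proof -
  obtain A c where A: "finite A" "A \<subseteq> G" "\<forall>g\<in>A. c g \<in> poly_ring V" "p = (\<Sum>g\<in>A. c g * g)"
    using assms(2) unfolding ideal_gen_def by blast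
  then have "h * p = (\<Sum>g\<in>A. (h * c g) * g)"
    by (simp add: sum_distrib_left mult.assoc)
  then show ?thesis
    unfolding ideal_gen_def using A(1-3) assms(1)
    by (intro CollectI exI[of _ A] exI[of _ "\<lambda>g. h * c g"]) (auto intro: poly_ring_mult)
qed

lemma ideal_gen_uminus: "p \<in> ideal_gen V G \<Longrightarrow> - p \<in> ideal_gen V G"
  using ideal_gen_mult[OF poly_ring_uminus[OF poly_ring_1], of p V G] by simp

lemma ideal_gen_sum: "(\<And>i. i \<in> A \<Longrightarrow> p i \<in> ideal_gen V G) \<Longrightarrow> (\<Sum>i\<in>A. p i) \<in> ideal_gen V G"
  by (induction A rule: infinite_finite_induct) (auto intro: ideal_gen_add ideal_gen_0)

lemma eval_ideal_gen:
  assumes "p \<in> ideal_gen V G" "\<forall>g\<in>G. eval_poly a g = 0"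
  shows "eval_poly a p = 0"
  using assms unfolding ideal_gen_def by (auto intro!: sum.neutral simp: subset_iff)

definition chi :: "'v set \<Rightarrow> 'v \<Rightarrow> real" where
  "chi S v = (if v \<in> S then 1 else 0)"

text \<open>The Lagrange interpolant: on the cube over \<open>V\<close> it is the indicator function of the vertex \<open>S\<close>.\<close>

definition vertex_poly :: "'v set \<Rightarrow> 'v set \<Rightarrow> 'v rpoly" where
  "vertex_poly V S = (\<Prod>v\<in>V. if v \<in> S then var_poly v else 1 - var_poly v)"

lemma vertex_factors_in_ring:
  "W \<subseteq> V \<Longrightarrow> (\<Prod>v\<in>W. if v \<in> S then var_poly v else 1 - var_poly v) \<in> poly_ring V"
  by (rule poly_ring_prod) (auto intro: poly_ring_intros)

lemma sum_vertex_poly: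
  assumes "finite V"
  shows "(\<Sum>S\<in>Pow V. vertex_poly V S) = 1"
proof -
  have "(\<Prod>v\<in>V. if v \<in> S then var_poly v else 1 - var_poly v)
      = (\<Prod>v\<in>S. var_poly v) * (\<Prod>v\<in>V - S. 1 - var_poly v :: 'a rpoly)"
    if "S \<subseteq> V" for S
  proof -
    have "V \<inter> S = S" "V \<inter> - S = V - S" using that by auto
    then show ?thesis by (simp add: prod.If_cases[OF assms])
  qed
  then have "(\<Sum>S\<in>Pow V. vertex_poly V S)
      = (\<Sum>S\<in>Pow V. (\<Prod>v\<in>S. var_poly v) * (\<Prod>v\<in>V - S. 1 - var_poly v))"
    unfolding vertex_poly_def by (intro sum.cong) auto
  also have "\<dots> = (\<Prod>v\<in>V. var_poly v + (1 - var_poly v))"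
    by (rule prod_add[OF assms, symmetric])
  finally show ?thesis by simp
qed

text \<open>
  Multiplying by the interpolant of a vertex amounts, modulo the ideal, to evaluating at that vertex:
  \<open>(x\<^sub>v - 1) x\<^sub>v\<close> and \<open>x\<^sub>v (1 - x\<^sub>v)\<close> are both multiples of \<open>x\<^sub>v\<^sup>2 - x\<^sub>v\<close>, which settles the variables,
  and the property is inherited by sums and products.
\<close>

lemma vertex_poly_localizes:
  assumes fin: "finite V" and bool: "\<And>v. v \<in> V \<Longrightarrow> (var_poly v)\<^sup>2 - var_poly v \<in> ideal_gen V G"
    and p: "p \<in> poly_ring V"
  shows "(p - const_poly (eval_poly (chi S) p)) * vertex_poly V S \<in> ideal_gen V G"
  using p
proof (induction rule: poly_ring_induct)
  case (const c)
  show ?case by (simp add: ideal_gen_0)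
next
  case (var v)
  let ?R = "\<Prod>w\<in>V - {v}. if w \<in> S then var_poly w else 1 - var_poly w :: 'a rpoly"
  have vp: "vertex_poly V S = (if v \<in> S then var_poly v else 1 - var_poly v) * ?R"
    unfolding vertex_poly_def using fin var by (rule prod.remove)
  have R: "?R \<in> poly_ring V" by (rule vertex_factors_in_ring) auto
  have eq: "(var_poly v - const_poly (eval_poly (chi S) (var_poly v))) * vertex_poly V S
      = (if v \<in> S then ?R else - ?R) * ((var_poly v)\<^sup>2 - var_poly v)"
    unfolding vp by (simp add: chi_def const_poly_def power2_eq_square algebra_simps)
  have "(if v \<in> S then ?R else - ?R) \<in> poly_ring V"
    using R poly_ring_uminus[OF R] by simp
  then show ?case
    unfolding eq by (rule ideal_gen_mult) (rule bool[OF var])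
next
  case (add p q)
  have "(p + q - const_poly (eval_poly (chi S) (p + q))) * vertex_poly V S
      = (p - const_poly (eval_poly (chi S) p)) * vertex_poly V S
        + (q - const_poly (eval_poly (chi S) q)) * vertex_poly V S"
    by (simp add: const_poly_def single_add algebra_simps)
  then show ?case using add.IH ideal_gen_add by metis
next
  case (mult p q)
  have "const_poly (eval_poly (chi S) (p * q))
      = const_poly (eval_poly (chi S) p) * (const_poly (eval_poly (chi S) q) :: 'a rpoly)"
    by (simp add: const_poly_def mult_single)
  then have "(p * q - const_poly (eval_poly (chi S) (p * q))) * vertex_poly V S
      = q * ((p - const_poly (eval_poly (chi S) p)) * vertex_poly V S)
        + const_poly (eval_poly (chi S) p) * ((q - const_poly (eval_poly (chi S) q)) * vertex_poly V S)"
    by (simp add: algebra_simps)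
  then show ?case
    using mult ideal_gen_add ideal_gen_mult poly_ring_const by metis
qed

text \<open>
  The interpolants add up to 1, so \<open>p\<close> is congruent to \<open>\<Sum>S. p(1\<^sub>S) \<delta>\<^sub>S\<close>, where \<open>\<delta>\<^sub>S\<close> interpolates the
  vertex \<open>S\<close>. A vertex is harmless either because \<open>p\<close> vanishes there or because the ideal
  contains \<open>\<delta>\<^sub>S\<close>, which is how further generators exclude a vertex.
\<close>

lemma boolean_nullstellensatz:
  assumes fin: "finite V" and bool: "\<And>v. v \<in> V \<Longrightarrow> (var_poly v)\<^sup>2 - var_poly v \<in> ideal_gen V G"
    and p: "p \<in> poly_ring V"
    and vertex: "\<And>S. S \<subseteq> V \<Longrightarrow> eval_poly (chi S) p = 0 \<or> vertex_poly V S \<in> ideal_gen V G"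
  shows "p \<in> ideal_gen V G"
proof -
  have "p * vertex_poly V S \<in> ideal_gen V G" if S: "S \<subseteq> V" for S
  proof -
    have "const_poly (eval_poly (chi S) p) * vertex_poly V S \<in> ideal_gen V G"
      using vertex[OF S] by (auto simp: const_poly_def ideal_gen_0
          intro: ideal_gen_mult poly_ring_const[unfolded const_poly_def])
    from ideal_gen_add[OF vertex_poly_localizes[OF fin bool p, of S] this]
    show ?thesis by (simp add: algebra_simps)
  qed
  then have "(\<Sum>S\<in>Pow V. p * vertex_poly V S) \<in> ideal_gen V G"
    by (intro ideal_gen_sum) auto
  then show ?thesis
    by (simp add: sum_vertex_poly[OF fin] flip: sum_distrib_left)
qed

definition cube_points :: "nat set \<Rightarrow> (nat \<Rightarrow> real) set" where
  "cube_points V = chi ` Pow V"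

definition xy_point :: "nat set \<Rightarrow> nat set \<Rightarrow> xyvar \<Rightarrow> real" where
  "xy_point S T v = (case v of xvar i \<Rightarrow> chi S i | yvar i \<Rightarrow> chi T i)"

definition chain_points :: "nat \<Rightarrow> (xyvar \<Rightarrow> real) set" where
  "chain_points n = {xy_point S T | S T. S \<subseteq> T \<and> T \<subseteq> {1..n}}"

lemma I2_iff_vanishes:
  assumes V: "finite V" and p: "p \<in> poly_ring V"
  shows "p \<in> I2 V \<longleftrightarrow> (\<forall>a\<in>cube_points V. eval_poly a p = 0)"
proof
  assume "p \<in> I2 V"
  then show "\<forall>a\<in>cube_points V. eval_poly a p = 0"
    unfolding I2_def by (intro ballI, elim eval_ideal_gen) (auto simp: cube_points_def chi_def)
next
  assume "\<forall>a\<in>cube_points V. eval_poly a p = 0"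
  then show "p \<in> I2 V"
    unfolding I2_def
    by (intro boolean_nullstellensatz[OF V _ p] ideal_gen_generator) (auto simp: cube_points_def)
qed

text \<open>
  A vertex \<open>(1\<^sub>S, 1\<^sub>T)\<close> of the \<open>2n\<close>-dimensional cube with \<open>i \<in> S - T\<close> is excluded by the generator
  \<open>x\<^sub>i y\<^sub>i - x\<^sub>i\<close>: up to sign this is the product of the two factors of the interpolant that belong to
  the variables with index \<open>i\<close>.
\<close>

lemma I1_iff_vanishes:
  assumes p: "p \<in> poly_ring (xyvars n)"
  shows "p \<in> I1 n \<longleftrightarrow> (\<forall>a\<in>chain_points n. eval_poly a p = 0)"
proof
  assume "p \<in> I1 n"
  then show "\<forall>a\<in>chain_points n. eval_poly a p = 0"
    unfolding I1_def
    by (intro ballI, elim eval_ideal_gen) (auto simp: chain_points_def xy_point_def chi_def)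
next
  assume van: "\<forall>a\<in>chain_points n. eval_poly a p = 0"
  let ?G = "\<Union>i\<in>{1..n}. {(x_poly i)\<^sup>2 - x_poly i, x_poly i * y_poly i - x_poly i, (y_poly i)\<^sup>2 - y_poly i}"
  show "p \<in> I1 n"
    unfolding I1_def
  proof (rule boolean_nullstellensatz[OF _ _ p])
    show fin: "finite (xyvars n)" by (simp add: xyvars_def)
    show "(var_poly v)\<^sup>2 - var_poly v \<in> ideal_gen (xyvars n) ?G" if "v \<in> xyvars n" for v
      using that by (intro ideal_gen_generator) (auto simp: xyvars_def)
    fix W assume W: "W \<subseteq> xyvars n"
    let ?S = "xvar -` W" and ?T = "yvar -` W"
    show "eval_poly (chi W) p = 0 \<or> vertex_poly (xyvars n) W \<in> ideal_gen (xyvars n) ?G"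
    proof (cases "?S \<subseteq> ?T")
      case True
      have "chi W = xy_point ?S ?T"
        by (auto simp: fun_eq_iff xy_point_def chi_def split: xyvar.split)
      moreover have "?T \<subseteq> {1..n}" using W by (auto simp: xyvars_def)
      ultimately have "chi W \<in> chain_points n" using True by (auto simp: chain_points_def)
      then show ?thesis using van by blast
    next
      case False
      then obtain i where i: "xvar i \<in> W" "yvar i \<notin> W" by auto
      then have iV: "xvar i \<in> xyvars n" "i \<in> {1..n}" "yvar i \<in> xyvars n - {xvar i}"
        using W by (auto simp: xyvars_def)
      let ?R = "\<Prod>w\<in>xyvars n - {xvar i} - {yvar i}. if w \<in> W then var_poly w else 1 - var_poly w"
      have R: "?R \<in> poly_ring (xyvars n)" by (rule vertex_factors_in_ring) auto
      have "vertex_poly (xyvars n) W = x_poly i * ((1 - y_poly i) * ?R)"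
        unfolding vertex_poly_def using fin iV i
        by (simp add: prod.remove[of "xyvars n" "xvar i"] prod.remove[of "xyvars n - {xvar i}" "yvar i"])
      also have "\<dots> = (- ?R) * (x_poly i * y_poly i - x_poly i)"
        by (simp add: algebra_simps)
      also have "\<dots> \<in> ideal_gen (xyvars n) ?G"
        using iV R by (intro ideal_gen_mult ideal_gen_generator poly_ring_uminus) auto
      finally show ?thesis ..
    qed
  qed
qed

section \<open>Sums of squares as functions on a point set\<close>

text \<open>
  Only the values of \<open>h\<close> on \<open>X\<close> matter, so that summands may be replaced by any functions that agree
  with them there; in particular a product with factors 0 and 1 may be replaced by its square.
\<close>

definition sos_on :: "'v set \<Rightarrow> nat \<Rightarrow> ('v \<Rightarrow> real) set \<Rightarrow> (('v \<Rightarrow> real) \<Rightarrow> real) \<Rightarrow> bool" where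
  "sos_on V t X h \<longleftrightarrow> (\<exists>(m::nat) q. (\<forall>r\<in>{1..m}. q r \<in> poly_ring_upto V t) \<and>
     (\<forall>a\<in>X. h a = (\<Sum>r=1..m. (eval_poly a (q r))\<^sup>2)))"

lemma sos_mod_iff_sos_on:
  assumes I: "\<And>p. p \<in> poly_ring V \<Longrightarrow> p \<in> I \<longleftrightarrow> (\<forall>a\<in>X. eval_poly a p = 0)"
    and p: "p \<in> poly_ring V"
  shows "sos_mod V t I p \<longleftrightarrow> sos_on V t X (\<lambda>a. eval_poly a p)"
proof -
  have iff: "p - (\<Sum>r=1..m. (q r)\<^sup>2) \<in> I \<longleftrightarrow>
      (\<forall>a\<in>X. eval_poly a p = (\<Sum>r=1..m. (eval_poly a (q r))\<^sup>2))"
    if "\<forall>r\<in>{1..m}. q r \<in> poly_ring_upto V t" for m :: nat and q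
  proof -
    have "p - (\<Sum>r=1..m. (q r)\<^sup>2) \<in> poly_ring V"
      using p that by (intro poly_ring_intros) (auto dest: poly_ring_uptoD)
    then show ?thesis by (simp add: I)
  qed
  have "sos_mod V t I p \<longleftrightarrow> (\<exists>(m::nat) q. (\<forall>r\<in>{1..m}. q r \<in> poly_ring_upto V t) \<and>
      p - (\<Sum>r=1..m. (q r)\<^sup>2) \<in> I)"
    by (simp add: sos_mod_def poly_ring_upto_def)
  also have "\<dots> \<longleftrightarrow> sos_on V t X (\<lambda>a. eval_poly a p)"
    unfolding sos_on_def by (intro ex_cong1 conj_cong refl iff)
  finally show ?thesis .
qed

lemma sos_on_add:
  assumes "sos_on V t X h" "sos_on V t X k"
  shows "sos_on V t X (\<lambda>a. h a + k a)"
proof -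
  obtain m :: nat and q where q: "\<forall>r\<in>{1..m}. q r \<in> poly_ring_upto V t"
    "\<forall>a\<in>X. h a = (\<Sum>r=1..m. (eval_poly a (q r))\<^sup>2)"
    using assms(1) unfolding sos_on_def by blast
  obtain m' :: nat and q' where q': "\<forall>r\<in>{1..m'}. q' r \<in> poly_ring_upto V t"
    "\<forall>a\<in>X. k a = (\<Sum>r=1..m'. (eval_poly a (q' r))\<^sup>2)"
    using assms(2) unfolding sos_on_def by blast
  let ?q = "\<lambda>r. if r \<le> m then q r else q' (r - m)"
  have "(\<Sum>r=1..m + m'. (eval_poly a (?q r))\<^sup>2)
      = (\<Sum>r=1..m. (eval_poly a (q r))\<^sup>2) + (\<Sum>r=1..m'. (eval_poly a (q' r))\<^sup>2)" for a
  proof -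
    have "(\<Sum>r=1..m + m'. (eval_poly a (?q r))\<^sup>2)
        = (\<Sum>r=1..m. (eval_poly a (?q r))\<^sup>2) + (\<Sum>r=m + 1..m + m'. (eval_poly a (?q r))\<^sup>2)"
      by (rule sum.ub_add_nat) simp
    also have "(\<Sum>r=m + 1..m + m'. (eval_poly a (?q r))\<^sup>2) = (\<Sum>r=1..m'. (eval_poly a (q' r))\<^sup>2)"
      using sum.shift_bounds_cl_nat_ivl[of "\<lambda>r. (eval_poly a (?q r))\<^sup>2" 1 m m'] by (simp add: add.commute)
    finally show ?thesis by simp
  qed
  moreover have "?q r \<in> poly_ring_upto V t" if "r \<in> {1..m + m'}" for r
    using that q(1)[rule_format, of r] q'(1)[rule_format, of "r - m"]
    by (auto simp: Suc_le_eq le_diff_conv add.commute)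
  ultimately show ?thesis
    unfolding sos_on_def using q(2) q'(2)
    by (intro exI[of _ "m + m'"] exI[of _ ?q]) simp
qed

lemma sos_on_sum:
  assumes "\<And>i. i \<in> A \<Longrightarrow> sos_on V t X (h i)"
  shows "sos_on V t X (\<lambda>a. \<Sum>i\<in>A. h i a)"
  using assms
proof (induction A rule: infinite_finite_induct)
  case (insert i A)
  then show ?case by (simp add: sos_on_add)
qed (auto simp: sos_on_def intro!: exI[of _ "0::nat"])

lemma sos_on_cong: "sos_on V t X h \<Longrightarrow> (\<And>a. a \<in> X \<Longrightarrow> h a = k a) \<Longrightarrow> sos_on V t X k"
  unfolding sos_on_def by metis

section \<open>Values of the multilinear extension and its derivatives\<close>

lemma eval_mle: "S \<subseteq> {1..n} \<Longrightarrow> eval_poly (chi S) (mle n f) = f S"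
  using is_mle_mle[of n f] by (simp add: is_mle_def chi_def[abs_def])

lemma chi_upd: "(chi S)(v := 1) = chi (insert v S)" "(chi S)(v := 0) = chi (S - {v})"
  by (auto simp: fun_eq_iff chi_def)

lemma partial_deriv_multilinear:
  assumes p: "p \<in> poly_ring V" and lin: "\<forall>m\<in>Poly_Mapping.keys p. \<forall>v. Poly_Mapping.lookup m v \<le> 1"
  shows "partial_deriv v p \<in> poly_ring (V - {v})"
    and "\<forall>m\<in>Poly_Mapping.keys (partial_deriv v p). \<forall>w. Poly_Mapping.lookup m w \<le> 1"
proof -
  have *: "Poly_Mapping.keys m \<subseteq> V - {v} \<and> (\<forall>w. Poly_Mapping.lookup m w \<le> 1)"
    if m: "m \<in> Poly_Mapping.keys (partial_deriv v p)" for m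
  proof -
    obtain m' where m': "m' \<in> Poly_Mapping.keys p" "m = m' - Poly_Mapping.single v 1"
      using m keys_sum[of _ "Poly_Mapping.keys p"] unfolding partial_deriv_def
      by (fastforce split: if_splits)
    have "Poly_Mapping.lookup m w \<le> 1" for w
      using lin m' by (auto simp: lookup_minus intro: order.trans[OF diff_le_self])
    moreover have "Poly_Mapping.lookup m v = 0"
      using lin m' by (simp add: lookup_minus)
    moreover have "Poly_Mapping.keys m \<subseteq> Poly_Mapping.keys m'"
      using m'(2) by (auto simp: in_keys_iff lookup_minus)
    moreover have "Poly_Mapping.keys m' \<subseteq> V"
      using p m'(1) by (auto simp: poly_ring_def indets_def)
    ultimately show ?thesis
      by (auto simp: in_keys_iff)
  qed
  show "partial_deriv v p \<in> poly_ring (V - {v})"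
    using * by (auto simp: poly_ring_def indets_def)
  show "\<forall>m\<in>Poly_Mapping.keys (partial_deriv v p). \<forall>w. Poly_Mapping.lookup m w \<le> 1"
    using * by blast
qed

lemma mle_multilinear:
  "mle n f \<in> poly_ring {1..n}"
  "\<forall>m\<in>Poly_Mapping.keys (mle n f). \<forall>v. Poly_Mapping.lookup m v \<le> 1"
  using is_mle_mle[of n f] by (simp_all add: is_mle_def)

lemma eval_partial_deriv_mle:
  assumes "S \<subseteq> {1..n}" "i \<in> {1..n}" "i \<notin> S"
  shows "eval_poly (chi S) (partial_deriv i (mle n f)) = f (insert i S) - f S"
  using assms mle_multilinear(2)[of n f]
  by (simp add: eval_partial_deriv chi_upd eval_mle)

lemma second_partial_deriv_mle_in_ring:
  "partial_deriv i (partial_deriv j (mle n f)) \<in> poly_ring ({1..n} - {i, j})"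
proof -
  have "{1..n} - {j} - {i} = {1..n} - {i, j}" by auto
  then show ?thesis
    using partial_deriv_multilinear(1)[OF partial_deriv_multilinear[OF mle_multilinear], of i j n f] by simp
qed

lemma eval_second_partial_deriv_mle:
  assumes "S \<subseteq> {1..n} - {i, j}" "i \<in> {1..n}" "j \<in> {1..n}" "i \<noteq> j"
  shows "eval_poly (chi S) (partial_deriv i (partial_deriv j (mle n f)))
    = f (insert j (insert i S)) - f (insert i S) - f (insert j S) + f S"
proof -
  have "i \<notin> S" "j \<notin> S" "S \<subseteq> {1..n}" using assms(1) by auto
  then show ?thesis
    using assms partial_deriv_multilinear(2)[OF mle_multilinear[of n f], of j]
    by (simp add: eval_partial_deriv chi_upd eval_partial_deriv_mle)
qed

lemma sos_submodular_iff_sos_on: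
  "sos_submodular t n f \<longleftrightarrow> (\<forall>i\<in>{1..n}. \<forall>j\<in>{1..n}. i \<noteq> j \<longrightarrow>
     sos_on ({1..n} - {i, j}) t (cube_points ({1..n} - {i, j}))
       (\<lambda>a. - eval_poly a (partial_deriv i (partial_deriv j (mle n f)))))"
proof -
  have "sos_mod ({1..n} - {i, j}) t (I2 ({1..n} - {i, j})) (- partial_deriv i (partial_deriv j (mle n f)))
      \<longleftrightarrow> sos_on ({1..n} - {i, j}) t (cube_points ({1..n} - {i, j}))
       (\<lambda>a. - eval_poly a (partial_deriv i (partial_deriv j (mle n f))))" for i j
    using sos_mod_iff_sos_on[OF I2_iff_vanishes poly_ring_uminus[OF second_partial_deriv_mle_in_ring]]
    by simp
  then show ?thesis unfolding sos_submodular_def by simp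
qed

lemma H1_in_ring: "H1 n (mle n f) \<in> poly_ring (xyvars n)"
proof -
  have "partial_deriv i (mle n f) \<in> poly_ring {1..n}" for i
    using partial_deriv_multilinear(1)[OF mle_multilinear, of i n f] by (auto simp: poly_ring_def)
  then show ?thesis
    unfolding H1_def using mle_multilinear(1)[of n f]
    by (intro poly_ring_intros poly_ring_subst[of _ "{1..n}"] poly_ring_upto_var)
      (auto simp: xyvars_def)
qed

lemma sos_H1_iff_sos_on:
  "sos_mod (xyvars n) t (I1 n) (H1 n (mle n f)) \<longleftrightarrow>
     sos_on (xyvars n) t (chain_points n) (\<lambda>a. eval_poly a (H1 n (mle n f)))"
  by (rule sos_mod_iff_sos_on[OF I1_iff_vanishes H1_in_ring])

lemma eval_H1:
  assumes "S \<subseteq> T" "T \<subseteq> {1..n}"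
  shows "eval_poly (xy_point S T) (H1 n (mle n f)) = f S - f T + (\<Sum>i\<in>T - S. f (insert i S) - f S)"
proof -
  have "(\<Sum>i=1..n. (chi T i - chi S i) * eval_poly (chi S) (partial_deriv i (mle n f)))
      = (\<Sum>i\<in>T - S. f (insert i S) - f S)"
  proof (intro sum.mono_neutral_cong_right)
    fix i assume "i \<in> T - S"
    then show "(chi T i - chi S i) * eval_poly (chi S) (partial_deriv i (mle n f)) = f (insert i S) - f S"
      using assms by (subst eval_partial_deriv_mle) (auto simp: chi_def)
  qed (use assms in \<open>auto simp: chi_def\<close>)
  then show ?thesis
    using assms by (simp add: H1_def xy_point_def eval_mle)
qed

section \<open>From submodularity to the gradient inequality\<close>

text \<open>
  The set \<open>Z l\<close> is the intermediate set between \<open>S\<close> and \<open>T\<close> just before \<open>l\<close> is added. Telescoping \<open>f\<close>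
  along these sets expresses \<open>f T - f S\<close> by the increments at \<open>Z k\<close>; telescoping each of these
  increments from \<open>S\<close> to \<open>Z k\<close> leaves second differences of \<open>f\<close>.
\<close>

lemma first_order_gap_telescopes:
  fixes f :: "nat set \<Rightarrow> real"
  assumes ST: "S \<subseteq> T" "T \<subseteq> {1..n}"
  defines "Z \<equiv> \<lambda>l. S \<union> (T \<inter> {..<l})"
  shows "f S - f T + (\<Sum>i\<in>T - S. f (insert i S) - f S)
    = (\<Sum>k=1..n. \<Sum>l=1..<k. if k \<in> T - S \<and> l \<in> T - S
        then - (f (insert k (insert l (Z l))) - f (insert l (Z l)) - f (insert k (Z l)) + f (Z l)) else 0)"
proof -
  have Z1: "Z 1 = S" and Zn: "Z (Suc n) = T"
    using ST by (auto simp: Z_def)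
  have step: "Z (Suc l) = (if l \<in> T - S then insert l (Z l) else Z l)" for l
    using ST by (auto simp: Z_def less_Suc_eq)
  have tele: "h (Z k) - h S = (\<Sum>l=1..<k. if l \<in> T - S then h (insert l (Z l)) - h (Z l) else 0)"
    if "1 \<le> k" for h :: "nat set \<Rightarrow> real" and k
  proof -
    have "h (Z k) - h (Z 1) = (\<Sum>l=1..<k. h (Z (Suc l)) - h (Z l))"
      using that by (rule sum_Suc_diff'[symmetric])
    also have "\<dots> = (\<Sum>l=1..<k. if l \<in> T - S then h (insert l (Z l)) - h (Z l) else 0)"
      by (intro sum.cong) (auto simp: step)
    finally show ?thesis unfolding Z1 .
  qed
  have "(\<Sum>i\<in>T - S. f (insert i S) - f S) = (\<Sum>k=1..n. if k \<in> T - S then f (insert k S) - f S else 0)"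
    using ST by (intro sum.mono_neutral_cong_left) auto
  moreover have "f T - f S = (\<Sum>k=1..n. if k \<in> T - S then f (insert k (Z k)) - f (Z k) else 0)"
    using tele[of "Suc n" f] by (simp add: Zn atLeastLessThanSuc_atLeastAtMost)
  ultimately have "f S - f T + (\<Sum>i\<in>T - S. f (insert i S) - f S)
      = (\<Sum>k=1..n. (if k \<in> T - S then f (insert k S) - f S else 0)
          - (if k \<in> T - S then f (insert k (Z k)) - f (Z k) else 0))"
    unfolding sum_subtractf by linarith
  also have "\<dots> = (\<Sum>k=1..n. \<Sum>l=1..<k. if k \<in> T - S \<and> l \<in> T - S
        then - (f (insert k (insert l (Z l))) - f (insert l (Z l)) - f (insert k (Z l)) + f (Z l)) else 0)"
  proof (rule sum.cong[OF refl])
    fix k assume k: "k \<in> {1..n}"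
    let ?g = "\<lambda>W. f (insert k W) - f W"
    show "(if k \<in> T - S then ?g S else 0) - (if k \<in> T - S then ?g (Z k) else 0)
      = (\<Sum>l=1..<k. if k \<in> T - S \<and> l \<in> T - S
          then - (f (insert k (insert l (Z l))) - f (insert l (Z l)) - f (insert k (Z l)) + f (Z l)) else 0)"
    proof (cases "k \<in> T - S")
      case True
      then have "?g S - ?g (Z k) = - (\<Sum>l=1..<k. if l \<in> T - S then ?g (insert l (Z l)) - ?g (Z l) else 0)"
        using tele[of k ?g] k by simp
      also have "\<dots> = (\<Sum>l=1..<k. if l \<in> T - S then - (?g (insert l (Z l)) - ?g (Z l)) else 0)"
        unfolding sum_negf[symmetric] by (intro sum.cong) auto
      finally show ?thesis using True
        by (simp only: if_True) (auto intro!: sum.cong)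
    qed auto
  qed
  finally show ?thesis .
qed

text \<open>
  The substitution \<open>z l\<close> replaces the first \<open>l - 1\<close> variables by \<open>y\<close> and the others by \<open>x\<close>: at
  \<open>(1\<^sub>S, 1\<^sub>T)\<close> this is the vertex of the set \<open>Z l\<close> in the telescoping identity. As it
  replaces variables by variables, it does not raise the degree of the certificates.
\<close>

lemma sos_submodular_imp_sos_H1:
  assumes "sos_submodular t n f"
  shows "sos_mod (xyvars n) (t + 2) (I1 n) (H1 n (mle n f))"
proof -
  define z where "z l v = (if v < l then y_poly v else x_poly v)" for l v :: nat
  define P where "P k l = (y_poly k - x_poly k) * (y_poly l - x_poly l)
    * subst_poly (z l) (- partial_deriv l (partial_deriv k (mle n f)))" for k l
  have eval_z: "(\<lambda>v. eval_poly (xy_point S T) (z l v)) = chi (S \<union> (T \<inter> {..<l}))"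
    if "S \<subseteq> T" for S T l
    using that by (auto simp: fun_eq_iff z_def xy_point_def chi_def)
  have xy: "eval_poly (xy_point S T) (y_poly k - x_poly k) = (if k \<in> T - S then 1 else 0)"
    if "S \<subseteq> T" for S T k
    using that by (auto simp: xy_point_def chi_def)
  have "sos_on (xyvars n) (t + 2) (chain_points n) (\<lambda>a. eval_poly a (P k l))"
    if k: "k \<in> {1..n}" and l: "l \<in> {1..<k}" for k l
  proof -
    let ?V = "{1..n} - {l, k}"
    have "l \<in> {1..n}" "l \<noteq> k" using k l by auto
    then have "sos_on ?V t (cube_points ?V)
        (\<lambda>a. - eval_poly a (partial_deriv l (partial_deriv k (mle n f))))"
      using assms k unfolding sos_submodular_iff_sos_on by blast
    then obtain m :: nat and q where q: "\<forall>r\<in>{1..m}. q r \<in> poly_ring_upto ?V t"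
      and eq: "\<forall>a\<in>cube_points ?V. - eval_poly a (partial_deriv l (partial_deriv k (mle n f)))
        = (\<Sum>r=1..m. (eval_poly a (q r))\<^sup>2)"
      unfolding sos_on_def by blast
    let ?q = "\<lambda>r. (y_poly k - x_poly k) * (y_poly l - x_poly l) * subst_poly (z l) (q r)"
    have "?q r \<in> poly_ring_upto (xyvars n) (t + 2)" if "r \<in> {1..m}" for r
    proof -
      have "?q r \<in> poly_ring_upto (xyvars n) (1 + 1 + t)"
      proof (intro poly_ring_upto_mult poly_ring_upto_diff poly_ring_upto_var)
        show "subst_poly (z l) (q r) \<in> poly_ring_upto (xyvars n) t"
        proof (rule poly_ring_upto_subst)
          show "q r \<in> poly_ring_upto ?V t" using q that by blast
          show "z l v \<in> poly_ring_upto (xyvars n) 1" if "v \<in> ?V" for v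
            using that by (auto simp: z_def xyvars_def intro!: poly_ring_upto_var)
        qed
      qed (use k l in \<open>auto simp: xyvars_def\<close>)
      then show ?thesis by (simp add: add.commute)
    qed
    moreover have "eval_poly a (P k l) = (\<Sum>r=1..m. (eval_poly a (?q r))\<^sup>2)" if aX: "a \<in> chain_points n" for a
    proof -
      obtain S T where a: "a = xy_point S T" "S \<subseteq> T" "T \<subseteq> {1..n}"
        using aX by (auto simp: chain_points_def)
      show ?thesis
      proof (cases "k \<in> T - S \<and> l \<in> T - S")
        case True
        have "chi (S \<union> (T \<inter> {..<l})) \<in> cube_points ?V"
          unfolding cube_points_def using a True l by (intro imageI) auto
        then show ?thesis
          using eq True a l
          by (simp add: P_def eval_z xy del: eval_poly_diff)
      next
        case False
        then show ?thesis
          using a by (auto simp: P_def xy simp del: eval_poly_diff)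
      qed
    qed
    ultimately show ?thesis
      unfolding sos_on_def by (intro exI[of _ m] exI[of _ ?q]) blast
  qed
  then have "sos_on (xyvars n) (t + 2) (chain_points n)
      (\<lambda>a. \<Sum>k=1..n. \<Sum>l=1..<k. eval_poly a (P k l))"
    by (intro sos_on_sum) auto
  then have "sos_on (xyvars n) (t + 2) (chain_points n) (\<lambda>a. eval_poly a (H1 n (mle n f)))"
  proof (rule sos_on_cong)
    fix a assume "a \<in> chain_points n"
    then obtain S T where a: "a = xy_point S T" and ST: "S \<subseteq> T" "T \<subseteq> {1..n}"
      by (auto simp: chain_points_def)
    show "(\<Sum>k=1..n. \<Sum>l=1..<k. eval_poly a (P k l)) = eval_poly a (H1 n (mle n f))"
      unfolding a eval_H1[OF ST] first_order_gap_telescopes[OF ST]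
    proof (intro sum.cong refl)
      fix k l assume k: "k \<in> {1..n}" and l: "l \<in> {1..<k}"
      let ?Z = "S \<union> (T \<inter> {..<l})"
      have "eval_poly (chi ?Z) (partial_deriv l (partial_deriv k (mle n f)))
          = f (insert k (insert l ?Z)) - f (insert l ?Z) - f (insert k ?Z) + f ?Z"
        if "k \<in> T - S" "l \<in> T - S"
        using that ST k l by (intro eval_second_partial_deriv_mle) auto
      then show "eval_poly (xy_point S T) (P k l) = (if k \<in> T - S \<and> l \<in> T - S
          then - (f (insert k (insert l ?Z)) - f (insert l ?Z) - f (insert k ?Z) + f ?Z) else 0)"
        using ST by (simp add: P_def eval_z xy del: eval_poly_diff)
    qed
  qed
  then show ?thesis
    unfolding sos_H1_iff_sos_on .
qed

section \<open>From the gradient inequality to submodularity\<close>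

primrec var_index :: "xyvar \<Rightarrow> nat" where
  "var_index (xvar i) = i"
| "var_index (yvar i) = i"

text \<open>
  The second difference of \<open>q\<close> in \<open>y\<^sub>i\<close> and \<open>y\<^sub>j\<close> between the values 0 and 1, restricted to
  \<open>x\<^sub>i = x\<^sub>j = 0\<close> and to \<open>y\<^sub>k = x\<^sub>k\<close> for the other indices. It is written out monomial by monomial
  because the cancellation that lowers the degree has then already taken place: a monomial without
  \<open>y\<^sub>i\<close> or without \<open>y\<^sub>j\<close> has difference 0, and the others lose these two variables.
\<close>

definition mixed_difference :: "nat \<Rightarrow> nat \<Rightarrow> xyvar rpoly \<Rightarrow> nat rpoly" where
  "mixed_difference i j q = (\<Sum>m \<in> {m \<in> Poly_Mapping.keys q.
       xvar i \<notin> Poly_Mapping.keys m \<and> xvar j \<notin> Poly_Mapping.keys m \<and>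
       yvar i \<in> Poly_Mapping.keys m \<and> yvar j \<in> Poly_Mapping.keys m}.
     const_poly (Poly_Mapping.lookup q m) *
     (\<Prod>v\<in>Poly_Mapping.keys m - {yvar i, yvar j}. var_poly (var_index v) ^ Poly_Mapping.lookup m v))"

lemma eval_mixed_difference:
  assumes ij: "i \<noteq> j" and S: "i \<notin> S" "j \<notin> S"
  shows "eval_poly (chi S) (mixed_difference i j q)
    = eval_poly (xy_point S (insert i (insert j S))) q - eval_poly (xy_point S (insert i S)) q
      - eval_poly (xy_point S (insert j S)) q + eval_poly (xy_point S S) q"
proof -
  define R where "R m = (\<Prod>v\<in>Poly_Mapping.keys m - {yvar i, yvar j}.
    chi S (var_index v) ^ Poly_Mapping.lookup m v)" for m :: "xyvar \<Rightarrow>\<^sub>0 nat"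
  define good where "good m \<longleftrightarrow> xvar i \<notin> Poly_Mapping.keys m \<and> xvar j \<notin> Poly_Mapping.keys m \<and>
       yvar i \<in> Poly_Mapping.keys m \<and> yvar j \<in> Poly_Mapping.keys m"
    for m :: "xyvar \<Rightarrow>\<^sub>0 nat"
  have split: "mon_eval (xy_point S T) m
      = chi T i ^ Poly_Mapping.lookup m (yvar i) * chi T j ^ Poly_Mapping.lookup m (yvar j) * R m"
    if T: "S \<subseteq> T" "T \<subseteq> insert i (insert j S)" for T m
  proof -
    let ?K = "Poly_Mapping.keys m - {yvar i, yvar j}"
    have "mon_eval (xy_point S T) m
        = (\<Prod>v\<in>insert (yvar i) (insert (yvar j) ?K). xy_point S T v ^ Poly_Mapping.lookup m v)"
      by (intro mon_eval_superset) auto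
    also have "\<dots> = chi T i ^ Poly_Mapping.lookup m (yvar i) * chi T j ^ Poly_Mapping.lookup m (yvar j)
        * (\<Prod>v\<in>?K. xy_point S T v ^ Poly_Mapping.lookup m v)"
      using ij by (simp add: xy_point_def mult.assoc)
    also have "(\<Prod>v\<in>?K. xy_point S T v ^ Poly_Mapping.lookup m v) = R m"
      unfolding R_def
    proof (intro prod.cong refl)
      fix v assume "v \<in> ?K"
      then show "xy_point S T v ^ Poly_Mapping.lookup m v = chi S (var_index v) ^ Poly_Mapping.lookup m v"
        using T by (cases v) (auto simp: xy_point_def chi_def)
    qed
    finally show ?thesis .
  qed
  have R0: "R m = 0" if "xvar i \<in> Poly_Mapping.keys m \<or> xvar j \<in> Poly_Mapping.keys m" for m
    using that
  proof
    assume "xvar i \<in> Poly_Mapping.keys m"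
    then show ?thesis unfolding R_def using S
      by (intro prod_zero bexI[of _ "xvar i"]) (auto simp: chi_def in_keys_iff)
  next
    assume "xvar j \<in> Poly_Mapping.keys m"
    then show ?thesis unfolding R_def using S
      by (intro prod_zero bexI[of _ "xvar j"]) (auto simp: chi_def in_keys_iff)
  qed
  have mon: "mon_eval (xy_point S (insert i (insert j S))) m - mon_eval (xy_point S (insert i S)) m
      - mon_eval (xy_point S (insert j S)) m + mon_eval (xy_point S S) m = (if good m then R m else 0)" for m
  proof -
    \<comment> \<open>Here \<open>0 ^ e\<close> is 1 if the exponent \<open>e\<close> is zero and 0 otherwise, which selects the monomials.\<close>
    have "mon_eval (xy_point S (insert i (insert j S))) m - mon_eval (xy_point S (insert i S)) m
        - mon_eval (xy_point S (insert j S)) m + mon_eval (xy_point S S) m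
        = (1 - 0 ^ Poly_Mapping.lookup m (yvar i)) * (1 - 0 ^ Poly_Mapping.lookup m (yvar j)) * R m"
      by (subst (1 2 3 4) split) (use ij S in \<open>auto simp: chi_def algebra_simps\<close>)
    also have "\<dots> = (if good m then R m else 0)"
      using R0[of m] by (auto simp: good_def in_keys_iff power_0_left)
    finally show ?thesis .
  qed
  have "eval_poly (chi S) (mixed_difference i j q)
      = (\<Sum>m\<in>{m \<in> Poly_Mapping.keys q. good m}. Poly_Mapping.lookup q m * R m)"
    by (simp add: mixed_difference_def good_def R_def)
  also have "\<dots> = (\<Sum>m\<in>Poly_Mapping.keys q. Poly_Mapping.lookup q m * (if good m then R m else 0))"
    by (intro sum.mono_neutral_cong_left) auto
  also have "\<dots> = (\<Sum>m\<in>Poly_Mapping.keys q. Poly_Mapping.lookup q m *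
      (mon_eval (xy_point S (insert i (insert j S))) m - mon_eval (xy_point S (insert i S)) m
        - mon_eval (xy_point S (insert j S)) m + mon_eval (xy_point S S) m))"
    unfolding mon ..
  also have "\<dots> = eval_poly (xy_point S (insert i (insert j S))) q - eval_poly (xy_point S (insert i S)) q
      - eval_poly (xy_point S (insert j S)) q + eval_poly (xy_point S S) q"
    by (simp add: eval_poly_superset[of "Poly_Mapping.keys q"] distrib_left right_diff_distrib
        sum.distrib sum_subtractf)
  finally show ?thesis .
qed

lemma mixed_difference_upto:
  assumes q: "q \<in> poly_ring_upto (xyvars n) (t + 2)" and ij: "i \<noteq> j"
  shows "mixed_difference i j q \<in> poly_ring_upto ({1..n} - {i, j}) t"
  unfolding mixed_difference_def
proof (rule poly_ring_upto_sum, elim CollectE conjE)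
  let ?V = "{1..n} - {i, j}"
  fix m assume m: "m \<in> Poly_Mapping.keys q"
    and x: "xvar i \<notin> Poly_Mapping.keys m" "xvar j \<notin> Poly_Mapping.keys m"
    and y: "yvar i \<in> Poly_Mapping.keys m" "yvar j \<in> Poly_Mapping.keys m"
  let ?K = "Poly_Mapping.keys m - {yvar i, yvar j}"
  have keys: "Poly_Mapping.keys m \<subseteq> xyvars n" and deg: "mon_degree m \<le> t + 2"
    using q m by (auto simp: poly_ring_upto_iff)
  have "(\<Prod>v\<in>?K. var_poly (var_index v) ^ Poly_Mapping.lookup m v)
      \<in> poly_ring_upto ?V (\<Sum>v\<in>?K. Poly_Mapping.lookup m v * 1)"
  proof (intro poly_ring_upto_prod poly_ring_upto_power poly_ring_upto_var order.refl)
    fix v assume "v \<in> ?K"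
    then show "var_index v \<in> ?V"
      using keys x by (cases v) (auto simp: xyvars_def)
  qed
  moreover have "(\<Sum>v\<in>?K. Poly_Mapping.lookup m v * 1) \<le> t"
  proof -
    have "mon_degree m = (\<Sum>v\<in>insert (yvar i) (insert (yvar j) ?K). Poly_Mapping.lookup m v)"
      by (intro mon_degree_superset) auto
    also have "\<dots> = Poly_Mapping.lookup m (yvar i) + Poly_Mapping.lookup m (yvar j)
        + (\<Sum>v\<in>?K. Poly_Mapping.lookup m v)"
      using ij by simp
    finally show ?thesis using deg y by (auto simp: in_keys_iff)
  qed
  ultimately have "(\<Prod>v\<in>?K. var_poly (var_index v) ^ Poly_Mapping.lookup m v) \<in> poly_ring_upto ?V t"
    by (rule poly_ring_upto_mono)
  from poly_ring_upto_mult[OF poly_ring_upto_const[of _ _ 0] this]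
  show "const_poly (Poly_Mapping.lookup q m) *
      (\<Prod>v\<in>?K. var_poly (var_index v) ^ Poly_Mapping.lookup m v) \<in> poly_ring_upto ?V t"
    by simp
qed

text \<open>
  Adding at most one element to \<open>S\<close> makes the value of \<open>H\<^sub>1\<close> zero, and real numbers whose squares add
  up to zero are zero. So of the four values of \<open>q\<^sub>r\<close> that enter its mixed difference, only the one with
  both \<open>i\<close> and \<open>j\<close> added can be nonzero.
\<close>

lemma sos_H1_imp_sos_submodular:
  assumes "sos_mod (xyvars n) (t + 2) (I1 n) (H1 n (mle n f))"
  shows "sos_submodular t n f"
  unfolding sos_submodular_iff_sos_on
proof (intro ballI impI)
  fix i j assume i: "i \<in> {1..n}" and j: "j \<in> {1..n}" and ij: "i \<noteq> j"
  let ?V = "{1..n} - {i, j}"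
  obtain m :: nat and q where q: "\<forall>r\<in>{1..m}. q r \<in> poly_ring_upto (xyvars n) (t + 2)"
    and eq: "\<forall>a\<in>chain_points n. eval_poly a (H1 n (mle n f)) = (\<Sum>r=1..m. (eval_poly a (q r))\<^sup>2)"
    using assms unfolding sos_H1_iff_sos_on sos_on_def by blast
  have H: "(\<Sum>r=1..m. (eval_poly (xy_point S T) (q r))\<^sup>2)
      = f S - f T + (\<Sum>i\<in>T - S. f (insert i S) - f S)"
    if "S \<subseteq> T" "T \<subseteq> {1..n}" for S T
  proof -
    have "xy_point S T \<in> chain_points n" using that by (auto simp: chain_points_def)
    from trans[OF eq[rule_format, OF this, symmetric] eval_H1[OF that]] show ?thesis .
  qed
  have vanish: "eval_poly (xy_point S T) (q r) = 0"
    if "S \<subseteq> T" "T \<subseteq> {1..n}" "T = S \<or> (\<exists>k. k \<notin> S \<and> T = insert k S)" "r \<in> {1..m}" for S T r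
  proof -
    have "f S - f T + (\<Sum>i\<in>T - S. f (insert i S) - f S) = 0"
      using that(3) by (auto simp: insert_Diff_if)
    then show ?thesis
      using H[OF that(1,2)] that(4) by (simp add: sum_nonneg_eq_0_iff)
  qed
  have "- eval_poly a (partial_deriv i (partial_deriv j (mle n f)))
      = (\<Sum>r=1..m. (eval_poly a (mixed_difference i j (q r)))\<^sup>2)" if aX: "a \<in> cube_points ?V" for a
  proof -
    obtain S where a: "a = chi S" and S: "S \<subseteq> ?V" using aX by (auto simp: cube_points_def)
    have iS: "i \<notin> S" "j \<notin> S" "S \<subseteq> {1..n}" using S by auto
    let ?T = "insert i (insert j S)"
    have "?T - S = {i, j}" using iS by auto
    then have "- eval_poly a (partial_deriv i (partial_deriv j (mle n f)))
        = f S - f ?T + (\<Sum>k\<in>?T - S. f (insert k S) - f S)"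
      using S i j ij by (simp add: a eval_second_partial_deriv_mle insert_commute)
    also have "\<dots> = (\<Sum>r=1..m. (eval_poly (xy_point S ?T) (q r))\<^sup>2)"
      using iS i j by (intro H[symmetric]) auto
    also have "\<dots> = (\<Sum>r=1..m. (eval_poly a (mixed_difference i j (q r)))\<^sup>2)"
    proof (intro sum.cong refl)
      fix r assume r: "r \<in> {1..m}"
      have "eval_poly (xy_point S (insert i S)) (q r) = 0" "eval_poly (xy_point S (insert j S)) (q r) = 0"
        "eval_poly (xy_point S S) (q r) = 0"
        using iS i j r by (auto intro!: vanish)
      then show "(eval_poly (xy_point S ?T) (q r))\<^sup>2 = (eval_poly a (mixed_difference i j (q r)))\<^sup>2"
        using iS ij by (simp add: a eval_mixed_difference)
    qed
    finally show ?thesis .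
  qed
  moreover have "mixed_difference i j (q r) \<in> poly_ring_upto ?V t" if "r \<in> {1..m}" for r
    using q that ij by (intro mixed_difference_upto) auto
  ultimately show "sos_on ?V t (cube_points ?V)
      (\<lambda>a. - eval_poly a (partial_deriv i (partial_deriv j (mle n f))))"
    unfolding sos_on_def by (intro exI[of _ m] exI[of _ "\<lambda>r. mixed_difference i j (q r)"]) blast
qed

theorem theorem3:
  fixes t n :: nat and f :: "nat set \<Rightarrow> real"
  shows "sos_submodular t n f \<longleftrightarrow> sos_mod (xyvars n) (t + 2) (I1 n) (H1 n (mle n f))"
  using sos_submodular_imp_sos_H1 sos_H1_imp_sos_submodular by blast

end
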